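(* Let $\mathbb{F}$ be a countable field and let $\mathbf{V}_{\mathbb{F}}$ be the variety of $\mathbb{F}$-algebras with quasi-inversion generated by $R_{\mathbb{F}}$. Every member of the variety $\mathbf{V}_{\mathbb{F}}$ has index at most $3$. In particular, the algebra $\mathcal{R}_{\mathbb{F}}(\Lambda):=\mathcal{R}_{\mathbf{V}_{\mathbb{F}}}(\Lambda)$ has index at most $3$, for every chain $\Lambda$.
   Context: The index of nilpotence of a nilpotent element $a$ of a ring $T$ is the least positive integer $n$ with $a^n=0$; the index of $T$ is the supremum of the indices of all nilpotent elements of $T$. "Countable" means at most countable. For a field $\mathbb{F}$, $\Sigma_{\mathbb{F}}$ is the similarity type with constants $0,1$, binary operations $-$ and $\cdot$, a unary operation $'$, and unary operations $h_\lambda$ ($\lambda\in\mathbb{F}$, multiplication by $\lambda$). $\mathbf{Reg}_{\mathbb{F}}$ is the variety of all unital $\mathbb{F}$-algebras endowed with a unary operation $x\mapsto x'$ satisfying the identity $xx'x=x$; its members are called $\mathbb{F}$-algebras with quasi-inversion. A variety of $\mathbb{F}$-algebras with quasi-inversion is a class of $\Sigma_{\mathbb{F}}$-structures defined by a set of identities and contained in $\mathbf{Reg}_{\mathbb{F}}$; the variety generated by a structure is the class of all $\Sigma_{\mathbb{F}}$-structures satisfying all identities satisfied by that structure. For such a variety $\mathbf{V}$ and a (possibly empty) chain $\Lambda$, $\mathcal{R}_{\mathbf{V}}(\Lambda)$ is the $\mathbf{V}$-object defined by generators $\tilde{\alpha}$ ($\alpha\in\Lambda$) and relations $\tilde{\alpha}=\tilde{\beta}\cdot\tilde{\alpha}$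 for all $\alpha\le\beta$ in $\Lambda$. Definition of $R_{\mathbb{F}}$: in $\mathbb{F}^{3\times3}$ let $A=\begin{pmatrix}1&0&0\\0&0&0\\0&0&0\end{pmatrix}$, $B=\begin{pmatrix}1&0&1\\0&1&0\\0&0&0\end{pmatrix}$, $I$ the identity matrix; let $\mathbb{F}[M]$ be the unital $\mathbb{F}$-subalgebra generated by $M$. One has $\mathbb{F}[A]\cap\mathbb{F}[B]=\mathbb{F}\cdot I$. For each $X\in\mathbb{F}^{3\times3}$ fix a quasi-inverse $X'$ of $X$ (i.e. $XX'X=X$) lying in the smallest member of $\{\mathbb{F}\cdot I,\mathbb{F}[A],\mathbb{F}[B],\mathbb{F}^{3\times3}\}$ containing $X$. $R_{\mathbb{F}}$ is $\mathbb{F}^{3\times3}$ endowed with this (fixed) quasi-inversion. *)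

theory Defs
  imports "HOL-Analysis.Cartesian_Space" "HOL-Algebra.Ring" "HOL-Library.Extended_Nat"
    "HOL-Library.Countable_Set"
begin

definition nilpotents :: "('a, 'm) ring_scheme \<Rightarrow> 'a set" where
  "nilpotents T = {a \<in> carrier T. \<exists>n::nat. 0 < n \<and> a [^]\<^bsub>T\<^esub> n = \<zero>\<^bsub>T\<^esub>}"

definition nilpotence_index :: "('a, 'm) ring_scheme \<Rightarrow> 'a \<Rightarrow> nat" where
  "nilpotence_index T a = (LEAST n. 0 < n \<and> a [^]\<^bsub>T\<^esub> n = \<zero>\<^bsub>T\<^esub>)"

definition ring_index :: "('a, 'm) ring_scheme \<Rightarrow> enat" where
  "ring_index T = (SUP a\<in>nilpotents T. enat (nilpotence_index T a))"

record ('f, 'a) qstruct =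
  qcarrier :: "'a set"
  qzero :: 'a
  qone :: 'a
  qdiff :: "'a \<Rightarrow> 'a \<Rightarrow> 'a"
  qmult :: "'a \<Rightarrow> 'a \<Rightarrow> 'a"
  qinv :: "'a \<Rightarrow> 'a"
  qscale :: "'f \<Rightarrow> 'a \<Rightarrow> 'a"

definition sigma_structure :: "('f, 'a) qstruct \<Rightarrow> bool" where
  "sigma_structure A \<longleftrightarrow>
     qzero A \<in> qcarrier A \<and> qone A \<in> qcarrier A \<and>
     (\<forall>x\<in>qcarrier A. \<forall>y\<in>qcarrier A. qdiff A x y \<in> qcarrier A \<and> qmult A x y \<in> qcarrier A) \<and>
     (\<forall>x\<in>qcarrier A. qinv A x \<in> qcarrier A \<and> (\<forall>c. qscale A c x \<in> qcarrier A))"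

datatype (dead 'f, vars: 'v) qterm =
    TVar 'v
  | TZero
  | TOne
  | TDiff "('f, 'v) qterm" "('f, 'v) qterm"
  | TMult "('f, 'v) qterm" "('f, 'v) qterm"
  | TInv "('f, 'v) qterm"
  | TScale 'f "('f, 'v) qterm"

primrec eval :: "('f, 'a) qstruct \<Rightarrow> ('v \<Rightarrow> 'a) \<Rightarrow> ('f, 'v) qterm \<Rightarrow> 'a" where
  "eval A v (TVar x) = v x"
| "eval A v TZero = qzero A"
| "eval A v TOne = qone A"
| "eval A v (TDiff s t) = qdiff A (eval A v s) (eval A v t)"
| "eval A v (TMult s t) = qmult A (eval A v s) (eval A v t)"
| "eval A v (TInv s) = qinv A (eval A v s)"
| "eval A v (TScale c s) = qscale A c (eval A v s)"

primrec subst :: "('v \<Rightarrow> ('f, 'w) qterm) \<Rightarrow> ('f, 'v) qterm \<Rightarrow> ('f, 'w) qterm" where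
  "subst \<sigma> (TVar x) = \<sigma> x"
| "subst \<sigma> TZero = TZero"
| "subst \<sigma> TOne = TOne"
| "subst \<sigma> (TDiff s t) = TDiff (subst \<sigma> s) (subst \<sigma> t)"
| "subst \<sigma> (TMult s t) = TMult (subst \<sigma> s) (subst \<sigma> t)"
| "subst \<sigma> (TInv s) = TInv (subst \<sigma> s)"
| "subst \<sigma> (TScale c s) = TScale c (subst \<sigma> s)"

type_synonym 'f qidentity = "('f, nat) qterm \<times> ('f, nat) qterm"

definition satisfies :: "('f, 'a) qstruct \<Rightarrow> 'f qidentity \<Rightarrow> bool" where
  "satisfies A e \<longleftrightarrow>
     (\<forall>v. range v \<subseteq> qcarrier A \<longrightarrow> eval A v (fst e) = eval A v (snd e))"

definition identities :: "('f, 'a) qstruct \<Rightarrow> 'f qidentity set" where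
  "identities A = {e. satisfies A e}"

text \<open>
  A variety is handled through a set of identities defining it: its members with elements in
  the type \<open>'a\<close> form the set \<open>models E\<close>, and \<open>'a\<close> is arbitrary.
\<close>

definition models :: "'f qidentity set \<Rightarrow> ('f, 'a) qstruct set" where
  "models E = {A. sigma_structure A \<and> (\<forall>e\<in>E. satisfies A e)}"

definition generated_variety :: "('f, 'b) qstruct \<Rightarrow> ('f, 'a) qstruct set" where
  "generated_variety B = models (identities B)"

definition sigma_hom ::
    "('f, 'a) qstruct \<Rightarrow> ('f, 'b) qstruct \<Rightarrow> ('a \<Rightarrow> 'b) \<Rightarrow> bool" where
  "sigma_hom A B h \<longleftrightarrow>
     h ` qcarrier A \<subseteq> qcarrier B \<and> h (qzero A) = qzero B \<and> h (qone A) = qone B \<and>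
     (\<forall>x\<in>qcarrier A. \<forall>y\<in>qcarrier A.
        h (qdiff A x y) = qdiff B (h x) (h y) \<and> h (qmult A x y) = qmult B (h x) (h y)) \<and>
     (\<forall>x\<in>qcarrier A. h (qinv A x) = qinv B (h x) \<and>
        (\<forall>c. h (qscale A c x) = qscale B c (h x)))"

text \<open>Addition is not in the signature; it is recovered as \<open>x + y = x - (0 - y)\<close>.\<close>

definition ring_reduct :: "('f, 'a) qstruct \<Rightarrow> 'a ring" where
  "ring_reduct A = \<lparr>carrier = qcarrier A, mult = qmult A, one = qone A, zero = qzero A,
     add = (\<lambda>x y. qdiff A x (qdiff A (qzero A) y))\<rparr>"

definition qi_algebra :: "('f::field, 'a) qstruct \<Rightarrow> bool" where
  "qi_algebra A \<longleftrightarrow> sigma_structure A \<and> ring (ring_reduct A) \<and>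
     (\<forall>x\<in>qcarrier A. \<forall>y\<in>qcarrier A. qdiff A x y = x \<ominus>\<^bsub>ring_reduct A\<^esub> y) \<and>
     (\<forall>x\<in>qcarrier A. \<forall>y\<in>qcarrier A. \<forall>c.
        qscale A c (x \<oplus>\<^bsub>ring_reduct A\<^esub> y) = qscale A c x \<oplus>\<^bsub>ring_reduct A\<^esub> qscale A c y) \<and>
     (\<forall>x\<in>qcarrier A. \<forall>c d.
        qscale A (c + d) x = qscale A c x \<oplus>\<^bsub>ring_reduct A\<^esub> qscale A d x \<and>
        qscale A (c * d) x = qscale A c (qscale A d x)) \<and>
     (\<forall>x\<in>qcarrier A. qscale A 1 x = x) \<and>
     (\<forall>x\<in>qcarrier A. \<forall>y\<in>qcarrier A. \<forall>c.
        qscale A c (qmult A x y) = qmult A (qscale A c x) y \<and>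
        qscale A c (qmult A x y) = qmult A x (qscale A c y)) \<and>
     (\<forall>x\<in>qcarrier A. qmult A (qmult A x (qinv A x)) x = x)"

lemma eval_closed:
  assumes "sigma_structure A" "\<And>x. x \<in> vars t \<Longrightarrow> v x \<in> qcarrier A"
  shows "eval A v t \<in> qcarrier A"
  using assms(2) by (induction t) (use assms(1) in \<open>auto simp: sigma_structure_def\<close>)

lemma eval_subst: "eval A v (subst \<sigma> t) = eval A (\<lambda>x. eval A v (\<sigma> x)) t"
  by (induction t) auto

lemma eval_cong: "(\<And>x. x \<in> vars t \<Longrightarrow> v x = w x) \<Longrightarrow> eval A v t = eval A w t"
  by (induction t) auto

lemma generated_variety_transfer:
  assumes "A \<in> generated_variety B"
    and "\<And>v :: nat \<Rightarrow> _. range v \<subseteq> qcarrier B \<Longrightarrow> eval B v s = eval B v t"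
    and "range w \<subseteq> qcarrier A"
  shows "eval A w s = eval A w t"
proof -
  have "(s, t) \<in> identities B"
    using assms(2) by (simp add: identities_def satisfies_def)
  with assms(1) have "satisfies A (s, t)"
    by (auto simp: generated_variety_def models_def)
  then show ?thesis using assms(3) by (simp add: satisfies_def)
qed

text \<open>\<open>qi_algebra\<close> is an equational class, so it contains the variety generated by any of its
  members.\<close>

lemma generated_variety_qi_algebra:
  fixes A :: "('f::field, 'a) qstruct" and B :: "('f, 'b) qstruct"
  assumes B: "qi_algebra B" and A: "A \<in> generated_variety B"
  shows "qi_algebra A"
proof -
  let ?x = "TVar 0" and ?y = "TVar (Suc 0)" and ?z = "TVar (Suc (Suc 0))"
  let ?pl = "\<lambda>s t. TDiff s (TDiff TZero t)"
  have sB: "sigma_structure B" using B by (simp add: qi_algebra_def)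
  have sA: "sigma_structure A" using A by (simp add: generated_variety_def models_def)
  define P where "P C s t \<longleftrightarrow> (\<forall>v. range v \<subseteq> qcarrier C \<longrightarrow> eval C v s = eval C v t)"
    for C :: "('f, 'a) qstruct" and s t :: "('f, nat) qterm"
  define Q where "Q s t \<longleftrightarrow> (\<forall>v. range v \<subseteq> qcarrier B \<longrightarrow> eval B v s = eval B v t)"
    for s t :: "('f, nat) qterm"
  have tr: "P A s t" if "Q s t" for s t
    using generated_variety_transfer[OF A] that unfolding P_def Q_def by blast
  interpret R: ring "ring_reduct B" using B by (simp add: qi_algebra_def)
  have cB: "carrier (ring_reduct B) = qcarrier B" by (simp add: ring_reduct_def)
  note Bs = B[unfolded qi_algebra_def]
  have ev: "eval B v (?pl s t) = eval B v s \<oplus>\<^bsub>ring_reduct B\<^esub> eval B v t"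
           "eval B v (TMult s t) = eval B v s \<otimes>\<^bsub>ring_reduct B\<^esub> eval B v t"
           "eval B v TZero = \<zero>\<^bsub>ring_reduct B\<^esub>" "eval B v TOne = \<one>\<^bsub>ring_reduct B\<^esub>" for v s t
    by (simp_all add: ring_reduct_def)
  have cl: "eval B v t \<in> carrier (ring_reduct B)" if "range v \<subseteq> qcarrier B" for v t
    unfolding cB by (rule eval_closed[OF sB]) (use that in auto)
  have clv: "v n \<in> carrier (ring_reduct B)" if "range v \<subseteq> qcarrier B" for v and n :: nat
    using that by (auto simp: cB)
  have df: "eval B v (TDiff s t) = eval B v s \<ominus>\<^bsub>ring_reduct B\<^esub> eval B v t"
    if "range v \<subseteq> qcarrier B" for v s t
    using Bs cl[OF that, of s] cl[OF that, of t] by (simp add: cB)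
  have Q: "Q (?pl (?pl ?x ?y) ?z) (?pl ?x (?pl ?y ?z))" "Q (?pl ?x ?y) (?pl ?y ?x)"
    "Q (?pl TZero ?x) ?x" "Q (?pl (TDiff TZero ?x) ?x) TZero"
    "Q (TMult (TMult ?x ?y) ?z) (TMult ?x (TMult ?y ?z))"
    "Q (TMult TOne ?x) ?x" "Q (TMult ?x TOne) ?x"
    "Q (TMult (?pl ?x ?y) ?z) (?pl (TMult ?x ?z) (TMult ?y ?z))"
    "Q (TMult ?z (?pl ?x ?y)) (?pl (TMult ?z ?x) (TMult ?z ?y))"
    "Q (TDiff ?x ?y) (?pl ?x (TDiff TZero ?y))"
    unfolding Q_def ev
    by (auto simp: df ev clv R.a_assoc R.m_assoc R.l_distr R.r_distr R.a_ac R.l_neg R.r_neg R.minus_eq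
        simp del: eval.simps(2-))
  have Q2: "Q (TScale c (?pl ?x ?y)) (?pl (TScale c ?x) (TScale c ?y))"
    "Q (TScale (c + d) ?x) (?pl (TScale c ?x) (TScale d ?x))"
    "Q (TScale (c * d) ?x) (TScale c (TScale d ?x))" "Q (TScale 1 ?x) ?x"
    "Q (TScale c (TMult ?x ?y)) (TMult (TScale c ?x) ?y)"
    "Q (TScale c (TMult ?x ?y)) (TMult ?x (TScale c ?y))"
    "Q (TMult (TMult ?x (TInv ?x)) ?x) ?x" for c d
    using Bs unfolding Q_def by (auto simp: ring_reduct_def image_subset_iff) metis
  define w where "w x y z = (\<lambda>n::nat. if n = 0 then x else if n = Suc 0 then y else z)"
    for x y z :: 'a
  have use: "eval A (w x y z) s = eval A (w x y z) t"
    if "Q s t" "x \<in> qcarrier A" "y \<in> qcarrier A" "z \<in> qcarrier A" for x y z s t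
    using tr[OF that(1)] that(2-) unfolding P_def by (simp add: w_def image_subset_iff)
  have w: "w x y z 0 = x" "w x y z (Suc 0) = y" "w x y z (Suc (Suc 0)) = z" for x y z
    by (simp_all add: w_def)
  note ax = Q[THEN use, simplified w eval.simps] Q2[THEN use, simplified w eval.simps]
  have "ring (ring_reduct A)"
  proof (rule ringI)
    show "abelian_group (ring_reduct A)"
    proof (rule abelian_groupI)
      fix x assume "x \<in> carrier (ring_reduct A)"
      then show "\<exists>y\<in>carrier (ring_reduct A). y \<oplus>\<^bsub>ring_reduct A\<^esub> x = \<zero>\<^bsub>ring_reduct A\<^esub>"
        using ax(4)[of x x x] sA
        by (auto simp: ring_reduct_def sigma_structure_def intro!: bexI[of _ "qdiff A (qzero A) x"])
    qed (use ax(1-3) sA in \<open>auto simp: ring_reduct_def sigma_structure_def\<close>)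
    show "Group.monoid (ring_reduct A)"
      by (rule monoidI) (use ax(5-7) sA in \<open>auto simp: ring_reduct_def sigma_structure_def\<close>)
  qed (use ax(8-9) in \<open>auto simp: ring_reduct_def\<close>)
  then interpret A: ring "ring_reduct A" .
  have "qdiff A x y = x \<ominus>\<^bsub>ring_reduct A\<^esub> y" if "x \<in> qcarrier A" "y \<in> qcarrier A" for x y
  proof -
    have "qdiff A (qzero A) y = \<ominus>\<^bsub>ring_reduct A\<^esub> y"
      by (rule A.minus_equality[symmetric])
        (use ax(4)[of y y y] sA that in \<open>auto simp: ring_reduct_def sigma_structure_def\<close>)
    then show ?thesis
      using ax(10)[of x y y] that by (simp add: A.minus_eq) (simp add: ring_reduct_def)
  qed
  then show ?thesis
    unfolding qi_algebra_def using sA \<open>ring (ring_reduct A)\<close> ax(11-)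
    by (auto simp: ring_reduct_def)
qed

definition terms_over :: "'v set \<Rightarrow> ('f, 'v) qterm set" where
  "terms_over X = {t. vars t \<subseteq> X}"

inductive_set pres_cong ::
    "'f qidentity set \<Rightarrow> 'v set \<Rightarrow> (('f, 'v) qterm \<times> ('f, 'v) qterm) set
      \<Rightarrow> (('f, 'v) qterm \<times> ('f, 'v) qterm) set"
  for E X Rl where
  refl: "t \<in> terms_over X \<Longrightarrow> (t, t) \<in> pres_cong E X Rl"
| sym: "(s, t) \<in> pres_cong E X Rl \<Longrightarrow> (t, s) \<in> pres_cong E X Rl"
| trans: "(s, t) \<in> pres_cong E X Rl \<Longrightarrow> (t, u) \<in> pres_cong E X Rl \<Longrightarrow> (s, u) \<in> pres_cong E X Rl"
| ident: "(s, t) \<in> E \<Longrightarrow> range \<sigma> \<subseteq> terms_over X \<Longrightarrow> (subst \<sigma> s, subst \<sigma> t) \<in> pres_cong E X Rl"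
| rel: "(s, t) \<in> Rl \<Longrightarrow> s \<in> terms_over X \<Longrightarrow> t \<in> terms_over X \<Longrightarrow> (s, t) \<in> pres_cong E X Rl"
| diff: "(s, s') \<in> pres_cong E X Rl \<Longrightarrow> (t, t') \<in> pres_cong E X Rl
    \<Longrightarrow> (TDiff s t, TDiff s' t') \<in> pres_cong E X Rl"
| mult: "(s, s') \<in> pres_cong E X Rl \<Longrightarrow> (t, t') \<in> pres_cong E X Rl
    \<Longrightarrow> (TMult s t, TMult s' t') \<in> pres_cong E X Rl"
| inv: "(s, s') \<in> pres_cong E X Rl \<Longrightarrow> (TInv s, TInv s') \<in> pres_cong E X Rl"
| scale: "(s, s') \<in> pres_cong E X Rl \<Longrightarrow> (TScale c s, TScale c s') \<in> pres_cong E X Rl"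

text \<open>
  The object of the variety \<open>models E\<close> with generators \<open>X\<close> and relations \<open>Rl\<close>, realised as a
  quotient of the term algebra. It depends on \<open>E\<close> only through \<open>models E\<close>: the lemmas \<open>presented_in_models\<close>, \<open>presented_relations\<close>,
  \<open>presented_exists_hom\<close> and \<open>presented_unique_hom\<close> below give its universal property.
\<close>

definition presented ::
    "'f qidentity set \<Rightarrow> 'v set \<Rightarrow> (('f, 'v) qterm \<times> ('f, 'v) qterm) set
      \<Rightarrow> ('f, ('f, 'v) qterm set) qstruct" where
  "presented E X Rl = (let K = pres_cong E X Rl in
    \<lparr>qcarrier = terms_over X // K,
     qzero = K `` {TZero},
     qone = K `` {TOne},
     qdiff = (\<lambda>C D. \<Union>s\<in>C. \<Union>t\<in>D. K `` {TDiff s t}),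
     qmult = (\<lambda>C D. \<Union>s\<in>C. \<Union>t\<in>D. K `` {TMult s t}),
     qinv = (\<lambda>C. \<Union>s\<in>C. K `` {TInv s}),
     qscale = (\<lambda>c C. \<Union>s\<in>C. K `` {TScale c s})\<rparr>)"

definition presented_gen ::
    "'f qidentity set \<Rightarrow> 'v set \<Rightarrow> (('f, 'v) qterm \<times> ('f, 'v) qterm) set
      \<Rightarrow> 'v \<Rightarrow> ('f, 'v) qterm set" where
  "presented_gen E X Rl x = pres_cong E X Rl `` {TVar x}"

lemma vars_subst: "vars (subst \<sigma> t) = (\<Union>x\<in>vars t. vars (\<sigma> x))"
  by (induction t) auto

lemma pres_cong_terms:
  "(s, t) \<in> pres_cong E X Rl \<Longrightarrow> s \<in> terms_over X \<and> t \<in> terms_over X"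
  by (induction rule: pres_cong.induct)
    (auto simp: terms_over_def vars_subst image_subset_iff subset_iff)

lemma equiv_pres_cong: "equiv (terms_over X) (pres_cong E X Rl)"
  by (intro equivI refl_onI symI transI)
    (auto intro: pres_cong.refl pres_cong.sym pres_cong.trans dest: pres_cong_terms)

context
  fixes E :: "'f qidentity set" and X :: "'v set"
    and Rl :: "(('f, 'v) qterm \<times> ('f, 'v) qterm) set"
begin

private abbreviation "K \<equiv> pres_cong E X Rl"
private abbreviation "Pr \<equiv> presented E X Rl"

lemma presented_class_simps2:
  assumes "s \<in> terms_over X" "t \<in> terms_over X"
  shows "qdiff Pr (K `` {s}) (K `` {t}) = K `` {TDiff s t}"
    and "qmult Pr (K `` {s}) (K `` {t}) = K `` {TMult s t}"
proof -
  note eq = equiv_class_eq[OF equiv_pres_cong]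
  note U2 = UN_equiv_class2[OF equiv_pres_cong equiv_pres_cong _ assms]
  show "qdiff Pr (K `` {s}) (K `` {t}) = K `` {TDiff s t}"
    unfolding presented_def Let_def qstruct.simps
    by (rule U2) (auto simp: congruent2_def intro!: eq pres_cong.diff)
  show "qmult Pr (K `` {s}) (K `` {t}) = K `` {TMult s t}"
    unfolding presented_def Let_def qstruct.simps
    by (rule U2) (auto simp: congruent2_def intro!: eq pres_cong.mult)
qed

lemma presented_class_simps1:
  assumes "s \<in> terms_over X"
  shows "qinv Pr (K `` {s}) = K `` {TInv s}"
    and "qscale Pr c (K `` {s}) = K `` {TScale c s}"
proof -
  note eq = equiv_class_eq[OF equiv_pres_cong]
  note U1 = UN_equiv_class[OF equiv_pres_cong _ assms]
  show "qinv Pr (K `` {s}) = K `` {TInv s}"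
    unfolding presented_def Let_def qstruct.simps
    by (rule U1) (auto simp: congruent_def intro!: eq pres_cong.inv)
  show "qscale Pr c (K `` {s}) = K `` {TScale c s}"
    unfolding presented_def Let_def qstruct.simps
    by (rule U1) (auto simp: congruent_def intro!: eq pres_cong.scale)
qed

lemmas presented_class_simps = presented_class_simps1 presented_class_simps2

lemma presented_carrierE:
  assumes "C \<in> qcarrier Pr" obtains t where "t \<in> terms_over X" "C = K `` {t}"
  using assms by (auto simp: presented_def Let_def elim: quotientE)

lemma class_in_presented: "t \<in> terms_over X \<Longrightarrow> K `` {t} \<in> qcarrier Pr"
  by (auto simp: presented_def Let_def intro: quotientI)

lemma sigma_structure_presented: "sigma_structure Pr"
proof -
  have "qzero Pr \<in> qcarrier Pr" "qone Pr \<in> qcarrier Pr"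
    by (auto simp: presented_def Let_def terms_over_def intro!: quotientI)
  then show ?thesis
    unfolding sigma_structure_def
    by (auto elim!: presented_carrierE simp: presented_class_simps
        intro!: class_in_presented) (auto simp: terms_over_def)
qed

lemma eval_presented:
  assumes "\<And>x. x \<in> vars t \<Longrightarrow> \<sigma> x \<in> terms_over X"
  shows "eval Pr (\<lambda>x. K `` {\<sigma> x}) t = K `` {subst \<sigma> t}"
proof -
  have st: "subst \<sigma> u \<in> terms_over X" if "vars u \<subseteq> vars t" for u
    using that assms by (auto simp: terms_over_def vars_subst)
  have "vars u \<subseteq> vars t \<Longrightarrow> eval Pr (\<lambda>x. K `` {\<sigma> x}) u = K `` {subst \<sigma> u}" for u
  proof (induction u)
    case TZero
    show ?case by (simp add: presented_def Let_def)
  next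
    case TOne
    show ?case by (simp add: presented_def Let_def)
  qed (auto simp: presented_class_simps st)
  then show ?thesis by blast
qed

lemma presented_in_models: "Pr \<in> models E"
proof -
  have "eval Pr v s = eval Pr v t" if st: "(s, t) \<in> E" and v: "range v \<subseteq> qcarrier Pr" for s t v
  proof -
    have "\<forall>n. \<exists>u. u \<in> terms_over X \<and> v n = K `` {u}"
      using v by (metis presented_carrierE rangeI subsetD)
    then obtain \<sigma> where \<sigma>: "\<And>n. \<sigma> n \<in> terms_over X" "\<And>n. v n = K `` {\<sigma> n}"
      by metis
    then have "v = (\<lambda>n. K `` {\<sigma> n})" by auto
    then have "eval Pr v s = K `` {subst \<sigma> s}" "eval Pr v t = K `` {subst \<sigma> t}"
      by (simp_all add: eval_presented \<sigma>)
    moreover have "(subst \<sigma> s, subst \<sigma> t) \<in> K"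
      using st \<sigma>(1) by (intro pres_cong.ident) auto
    ultimately show ?thesis by (simp add: equiv_class_eq[OF equiv_pres_cong])
  qed
  then show ?thesis
    by (auto simp: models_def satisfies_def sigma_structure_presented)
qed

lemma presented_gen_in: "x \<in> X \<Longrightarrow> presented_gen E X Rl x \<in> qcarrier Pr"
  unfolding presented_gen_def by (rule class_in_presented) (simp add: terms_over_def)

lemma eval_presented_gen:
  assumes "t \<in> terms_over X" shows "eval Pr (presented_gen E X Rl) t = K `` {t}"
proof -
  have "subst TVar t = t" by (induction t) auto
  then show ?thesis
    using eval_presented[of t TVar] assms
    by (auto simp: terms_over_def presented_gen_def[abs_def] subset_iff)
qed

lemma presented_relations:
  assumes "(s, t) \<in> Rl" "s \<in> terms_over X" "t \<in> terms_over X"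
  shows "eval Pr (presented_gen E X Rl) s = eval Pr (presented_gen E X Rl) t"
  using assms by (simp add: eval_presented_gen equiv_class_eq[OF equiv_pres_cong pres_cong.rel])

lemma pres_cong_sound:
  assumes A: "A \<in> models E" and g: "\<And>x. x \<in> X \<Longrightarrow> g x \<in> qcarrier A"
    and r: "\<And>s t. (s, t) \<in> Rl \<Longrightarrow> eval A g s = eval A g t"
    and st: "(s, t) \<in> K"
  shows "eval A g s = eval A g t"
  using st
proof (induction rule: pres_cong.induct)
  case (ident s t \<sigma>)
  have "satisfies A (s, t)" using A ident(1) by (auto simp: models_def)
  moreover have "eval A g (\<sigma> n) \<in> qcarrier A" for n
    by (rule eval_closed) (use A ident(2) g in \<open>auto simp: models_def terms_over_def subset_iff image_iff\<close>)
  ultimately show ?case by (simp add: eval_subst satisfies_def image_subset_iff)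
qed (use r in auto)

lemma presented_exists_hom:
  assumes A: "A \<in> models E" and g: "\<And>x. x \<in> X \<Longrightarrow> g x \<in> qcarrier A"
    and r: "\<And>s t. (s, t) \<in> Rl \<Longrightarrow> eval A g s = eval A g t"
  shows "\<exists>h. sigma_hom Pr A h \<and> (\<forall>x\<in>X. h (presented_gen E X Rl x) = g x)"
proof -
  define h where "h C = eval A g (SOME t. t \<in> C)" for C
  have h: "h (K `` {t}) = eval A g t" if "t \<in> terms_over X" for t
  proof -
    have "(SOME u. u \<in> K `` {t}) \<in> K `` {t}"
      by (rule someI[of _ t]) (use that pres_cong.refl in auto)
    then show ?thesis using pres_cong_sound[OF A g r] unfolding h_def by fastforce
  qed
  have ev: "eval A g t \<in> qcarrier A" if "t \<in> terms_over X" for t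
    by (rule eval_closed) (use A g that in \<open>auto simp: models_def terms_over_def\<close>)
  have "h (qzero Pr) = qzero A" "h (qone Pr) = qone A"
    using h[of TZero] h[of TOne] by (auto simp: presented_def Let_def terms_over_def)
  moreover have "TInv s \<in> terms_over X" "TScale c s \<in> terms_over X" if "s \<in> terms_over X"
    for s :: "('f, 'v) qterm" and c
    using that by (auto simp: terms_over_def)
  moreover have "TDiff s t \<in> terms_over X" "TMult s t \<in> terms_over X"
    if "s \<in> terms_over X" "t \<in> terms_over X" for s t :: "('f, 'v) qterm"
    using that by (auto simp: terms_over_def)
  ultimately have "sigma_hom Pr A h"
    unfolding sigma_hom_def
    by (auto elim!: presented_carrierE simp: presented_class_simps h ev)
  moreover have "\<forall>x\<in>X. h (presented_gen E X Rl x) = g x"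
    by (auto simp: presented_gen_def h terms_over_def)
  ultimately show ?thesis by blast
qed

lemma presented_unique_hom:
  assumes h: "sigma_hom Pr A h" "sigma_hom Pr A k"
    and eq: "\<And>x. x \<in> X \<Longrightarrow> h (presented_gen E X Rl x) = k (presented_gen E X Rl x)"
    and C: "C \<in> qcarrier Pr"
  shows "h C = k C"
proof -
  have "t \<in> terms_over X \<Longrightarrow> h (eval Pr (presented_gen E X Rl) t) = k (eval Pr (presented_gen E X Rl) t)"
    for t
  proof (induction t)
    case (TVar x)
    then show ?case by (simp add: terms_over_def eq)
  qed (use h eval_closed[OF sigma_structure_presented, of _ "presented_gen E X Rl"] presented_gen_in
      in \<open>auto simp: terms_over_def sigma_hom_def subset_iff\<close>)
  then show ?thesis using C by (metis presented_carrierE eval_presented_gen)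
qed

end

text \<open>
  The algebra of a chain \<open>L\<close> with order relation \<open>r\<close> in the variety \<open>models E\<close>. The pair
  \<open>(\<alpha>, \<beta>) \<in> r\<close> means \<open>\<alpha> \<le> \<beta>\<close>.
\<close>

definition chain_algebra ::
    "'f qidentity set \<Rightarrow> 'l set \<Rightarrow> 'l rel \<Rightarrow> ('f, ('f, 'l) qterm set) qstruct" where
  "chain_algebra E L r =
     presented E L {(TVar \<alpha>, TMult (TVar \<beta>) (TVar \<alpha>)) | \<alpha> \<beta>. (\<alpha>, \<beta>) \<in> r}"

definition mscale :: "'f::field \<Rightarrow> 'f^3^3 \<Rightarrow> 'f^3^3" where
  "mscale c X = (\<chi> i j. c * X $ i $ j)"

definition matA :: "'f::field^3^3" where
  "matA = vector [vector [1, 0, 0], vector [0, 0, 0], vector [0, 0, 0]]"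

definition matB :: "'f::field^3^3" where
  "matB = vector [vector [1, 0, 1], vector [0, 1, 0], vector [0, 0, 0]]"

inductive_set gen_subalgebra :: "'f::field^3^3 \<Rightarrow> ('f^3^3) set" for M where
  gen: "M \<in> gen_subalgebra M"
| unit: "mat 1 \<in> gen_subalgebra M"
| add: "X \<in> gen_subalgebra M \<Longrightarrow> Y \<in> gen_subalgebra M \<Longrightarrow> X + Y \<in> gen_subalgebra M"
| mult: "X \<in> gen_subalgebra M \<Longrightarrow> Y \<in> gen_subalgebra M \<Longrightarrow> X ** Y \<in> gen_subalgebra M"
| scale: "X \<in> gen_subalgebra M \<Longrightarrow> mscale c X \<in> gen_subalgebra M"

definition subalgebra_family :: "('f::field^3^3) set set" where
  "subalgebra_family =
     {range (\<lambda>c. mscale c (mat 1)), gen_subalgebra matA, gen_subalgebra matB, UNIV}"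

definition smallest_containing :: "'f::field^3^3 \<Rightarrow> ('f^3^3) set \<Rightarrow> bool" where
  "smallest_containing X S \<longleftrightarrow> S \<in> subalgebra_family \<and> X \<in> S \<and>
     (\<forall>T\<in>subalgebra_family. X \<in> T \<longrightarrow> S \<subseteq> T)"

definition admissible_quasi_inversion :: "('f::field^3^3 \<Rightarrow> 'f^3^3) \<Rightarrow> bool" where
  "admissible_quasi_inversion q \<longleftrightarrow>
     (\<forall>X. X ** q X ** X = X \<and> (\<exists>S. smallest_containing X S \<and> q X \<in> S))"

definition R_alg :: "('f::field^3^3 \<Rightarrow> 'f^3^3) \<Rightarrow> ('f, 'f^3^3) qstruct" where
  "R_alg q = \<lparr>qcarrier = UNIV, qzero = 0, qone = mat 1, qdiff = (-), qmult = (**),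
     qinv = q, qscale = mscale\<rparr>"

lemma matrix_add_distrib_right: "(X + Y) ** Z = X ** Z + Y ** (Z :: 'f::field^3^3)"
  by (simp add: matrix_matrix_mult_def vec_eq_iff sum.distrib algebra_simps)

lemma qi_algebra_R_alg:
  assumes "admissible_quasi_inversion q" shows "qi_algebra (R_alg q)"
proof -
  have r: "ring_reduct (R_alg q) = \<lparr>carrier = UNIV, mult = (**), one = mat 1, zero = 0, add = (+)\<rparr>"
    by (simp add: ring_reduct_def R_alg_def fun_eq_iff)
  have "ring (ring_reduct (R_alg q))"
    unfolding r
  proof (rule ringI)
    show "abelian_group \<lparr>carrier = UNIV, mult = (**), one = mat 1, zero = 0, add = (+)::'a^3^3\<Rightarrow>_\<rparr>"
      by (rule abelian_groupI) (auto simp: algebra_simps intro: exI[of _ "- _"] left_minus)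
    show "Group.monoid \<lparr>carrier = UNIV, mult = (**), one = mat 1, zero = 0, add = (+)::'a^3^3\<Rightarrow>_\<rparr>"
      by (rule monoidI) (auto simp: matrix_mul_assoc)
  qed (auto simp: matrix_add_distrib_right matrix_add_ldistrib)
  then interpret R: ring "ring_reduct (R_alg q)" .
  have neg: "\<ominus>\<^bsub>ring_reduct (R_alg q)\<^esub> y = - y" for y
    by (rule R.minus_equality) (auto simp: r)
  have "x - y = x \<ominus>\<^bsub>ring_reduct (R_alg q)\<^esub> y" for x y
    unfolding R.minus_eq neg by (simp add: r)
  then show ?thesis
    unfolding qi_algebra_def using R.ring_axioms assms
    by (auto simp: sigma_structure_def R_alg_def[of q] admissible_quasi_inversion_def)
      (auto simp: ring_reduct_def mscale_def vec_eq_iff matrix_matrix_mult_def sum_distrib_left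
        algebra_simps)
qed

definition melt :: "'f::field^3^3 \<Rightarrow> 'f \<Rightarrow> 'f \<Rightarrow> 'f^3^3" where
  "melt M a b = mscale a (mat 1) + mscale b M"

lemma mscale_matrix_mul:
  "mscale c X ** Y = mscale c (X ** Y)" "X ** mscale c Y = mscale c (X ** Y)"
  "mscale c (mscale d X) = mscale (c * d) X" "mscale c (X + Y) = mscale c X + mscale c Y"
  "mscale (c + d) X = mscale c X + mscale d X"
  by (auto simp: mscale_def vec_eq_iff matrix_matrix_mult_def sum_distrib_left algebra_simps)

lemma melt_mult:
  assumes "M ** M = M"
  shows "melt M a b ** melt M c d = melt M (a * c) (a * d + b * c + b * d)"
  using assms by (simp add: melt_def matrix_add_distrib_right matrix_add_ldistrib mscale_matrix_mul
      algebra_simps)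

lemma gen_subalgebra_idem:
  assumes M: "M ** M = M" shows "gen_subalgebra M = {melt M a b | a b. True}"
proof (intro equalityI subsetI)
  fix X assume "X \<in> gen_subalgebra M"
  then show "X \<in> {melt M a b | a b. True}"
  proof induction
    case gen
    have "M = melt M 0 1" by (simp add: melt_def mscale_def vec_eq_iff)
    then show ?case by blast
  next
    case unit
    have "mat 1 = melt M 1 0" by (simp add: melt_def mscale_def vec_eq_iff)
    then show ?case by blast
  next
    case (add X Y)
    have "melt M a b + melt M c d = melt M (a + c) (b + d)" for a b c d
      by (simp add: melt_def mscale_matrix_mul)
    then show ?case using add by blast
  next
    case (mult X Y)
    then show ?case using melt_mult[OF M] by blast
  next
    case (scale X c)
    have "mscale c (melt M a b) = melt M (c * a) (c * b)" for a b
      by (simp add: melt_def mscale_matrix_mul)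
    then show ?case using scale by blast
  qed
next
  fix X assume "X \<in> {melt M a b | a b. True}"
  then show "X \<in> gen_subalgebra M"
    unfolding melt_def by (auto intro: gen_subalgebra.intros)
qed

lemma melt_regular:
  fixes M :: "'f::field^3^3"
  assumes M: "M ** M = M" shows "\<exists>c d. melt M a b ** melt M c d ** melt M a b = melt M a b"
proof -
  define c where "c = inverse a"
  define d where "d = inverse (a + b) - inverse a"
  have r: "x * inverse x * x = x" for x :: 'f by (cases "x = 0") auto
  have 1: "a * c * a = a" by (simp add: c_def r)
  have 2: "(a + b) * (c + d) * (a + b) = a + b" by (simp add: c_def d_def r)
  have "a * c * b + (a * d + b * c + b * d) * a + (a * d + b * c + b * d) * b
      = (a + b) * (c + d) * (a + b) - a * c * a"
    by (simp add: algebra_simps)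
  also have "\<dots> = b" unfolding 1 2 by simp
  finally have "melt M a b ** melt M c d ** melt M a b = melt M a b"
    by (simp only: melt_mult[OF M] 1)
  then show ?thesis by blast
qed

lemma matrix_regular: "\<exists>Y. X ** Y ** X = (X :: 'f::field^3^3)"
proof -
  obtain g where g: "Vector_Spaces.linear (*s) (*s) g" "\<And>v. v \<in> range ((*v) X) \<Longrightarrow> X *v g v = v"
    using vec.linear_exists_right_inverse_on[OF matrix_vector_mul_linear_gen vec.subspace_UNIV, of X]
    by blast
  have "X ** matrix g ** X = X"
    unfolding matrix_eq
    by (simp add: matrix_vector_mul_assoc[symmetric] matrix_works[OF g(1)] g(2))
  then show ?thesis by blast
qed

lemma admissible_quasi_inversion_exists:
  "\<exists>q :: 'f::field^3^3 \<Rightarrow> 'f^3^3. admissible_quasi_inversion q"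
proof -
  let ?Z = "range (\<lambda>c. mscale c (mat 1)) :: ('f^3^3) set"
  let ?A = "matA :: 'f^3^3" and ?B = "matB :: 'f^3^3"
  have A: "?A ** ?A = ?A" and B: "?B ** ?B = ?B"
    by (simp_all add: matA_def matB_def vec_eq_iff forall_3 matrix_matrix_mult_def sum_3)
  note gA = gen_subalgebra_idem[OF A] and gB = gen_subalgebra_idem[OF B]
  have Z: "mscale c (mat 1) = melt M c 0" for c :: 'f and M
    by (simp add: melt_def mscale_def vec_eq_iff)
  have Zs: "?Z \<subseteq> gen_subalgebra ?A" "?Z \<subseteq> gen_subalgebra ?B"
    by (auto intro: gen_subalgebra.intros)
  have I: "gen_subalgebra ?A \<inter> gen_subalgebra ?B \<subseteq> ?Z"
  proof
    fix X assume "X \<in> gen_subalgebra ?A \<inter> gen_subalgebra ?B"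
    then obtain a b c d where X: "X = melt ?A a b" "X = melt ?B c d"
      unfolding gA gB by blast
    then have "melt ?A a b $ 1 $ 3 = melt ?B c d $ 1 $ 3" by simp
    then have "d = 0" by (simp add: melt_def mscale_def matA_def matB_def mat_def)
    then show "X \<in> ?Z" using X(2) Z by auto
  qed
  have "\<exists>Y. X ** Y ** X = X \<and> (\<exists>S. smallest_containing X S \<and> Y \<in> S)" for X :: "'f^3^3"
  proof -
    consider "X \<in> ?Z" | "X \<notin> ?Z" "X \<in> gen_subalgebra ?A" | "X \<notin> ?Z" "X \<in> gen_subalgebra ?B"
      | "X \<notin> ?Z" "X \<notin> gen_subalgebra ?A" "X \<notin> gen_subalgebra ?B" by blast
    then show ?thesis
    proof cases
      case 1
      then obtain a where a: "X = mscale a (mat 1)" by blast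
      have "smallest_containing X ?Z"
        using 1 Zs by (auto simp: smallest_containing_def subalgebra_family_def)
      moreover have "X ** mscale (inverse a) (mat 1) ** X = X"
        by (cases "a = 0") (simp_all add: a mscale_matrix_mul)
      ultimately show ?thesis by blast
    next
      case 2
      then have "smallest_containing X (gen_subalgebra ?A)"
        using I unfolding smallest_containing_def subalgebra_family_def by blast
      moreover have "\<exists>Y\<in>gen_subalgebra ?A. X ** Y ** X = X"
        using 2(2) melt_regular[OF A] unfolding gA by blast
      ultimately show ?thesis by blast
    next
      case 3
      then have "smallest_containing X (gen_subalgebra ?B)"
        using I unfolding smallest_containing_def subalgebra_family_def by blast
      moreover have "\<exists>Y\<in>gen_subalgebra ?B. X ** Y ** X = X"
        using 3(2) melt_regular[OF B] unfolding gB by blast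
      ultimately show ?thesis by blast
    next
      case 4
      then have "smallest_containing X UNIV"
        by (auto simp: smallest_containing_def subalgebra_family_def)
      then show ?thesis using matrix_regular[of X] by blast
    qed
  qed
  then obtain q where "\<And>X :: 'f^3^3. X ** q X ** X = X \<and> (\<exists>S. smallest_containing X S \<and> q X \<in> S)"
    by metis
  then show ?thesis unfolding admissible_quasi_inversion_def by blast
qed

end

theory Submission
  imports Defs
begin

text \<open>
  The images of the powers of an \<open>n \<times> n\<close> matrix \<open>X\<close> stabilise from the \<open>n\<close>-th power on. As
  \<open>Y Y'\<close> acts as the identity on the image of \<open>Y\<close>, the algebra of all \<open>3 \<times> 3\<close> matrices satisfies
  \<open>x^(k+1) (x^(k+1))' x^k = x^k\<close> for \<open>k \<ge> 3\<close>. This identity passes to the whole variety, where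
  it turns \<open>a^(k+1) = 0\<close> into \<open>a^k = 0\<close>.
\<close>

text \<open>The ranges form a descending chain of subspaces in which one equality propagates to all
  later steps. Were step \<open>k\<close> still strict, so would be all \<open>k + 1\<close> steps
  up to it, more than the dimension allows.\<close>

lemma range_matrix_funpow_stabilises:
  fixes X :: "'f::field^'n^'n"
  assumes "CARD('n) \<le> k"
  shows "range (((*v) X) ^^ k) = range (((*v) X) ^^ Suc k)"
proof (rule ccontr)
  define R where "R j = range (((*v) X) ^^ j)" for j
  \<comment> \<open>The new factor is split off on the left to get an image, and on the right in
    \<open>anti\<close> to get an inclusion.\<close>
  have Suc_image: "R (Suc j) = (*v) X ` R j" for j
    by (simp add: R_def image_comp)
  have anti: "R (Suc j) \<subseteq> R j" for j
    by (auto simp: R_def funpow_Suc_right simp del: funpow.simps)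
  have sub: "vec.subspace (R j)" for j
  proof (induction j)
    case (Suc j)
    then show ?case
      unfolding Suc_image
      by (rule vec.linear_subspace_image[OF matrix_vector_mul_linear_gen])
  qed (simp add: R_def vec.subspace_UNIV)
  assume "range (((*v) X) ^^ k) \<noteq> range (((*v) X) ^^ Suc k)"
  then have neq: "R k \<noteq> R (Suc k)" unfolding R_def .
  \<comment> \<open>Downward from \<open>k\<close>: applying \<open>X\<close> to
    \<open>R j = R (Suc j)\<close> would give equality at the next step.\<close>
  have strict: "R j \<noteq> R (Suc j)" if "j \<le> k" for j
    using that neq by (induction rule: inc_induct) (use Suc_image in metis)+
  \<comment> \<open>Each strict inclusion costs at least one dimension; at \<open>j = Suc k\<close>
    the bound contradicts the assumption on \<open>k\<close>.\<close>
  have "vec.dim (R j) + j \<le> CARD('n)" if "j \<le> Suc k" for j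
    using that
  proof (induction j)
    case 0
    show ?case by (simp add: R_def card_cart_basis)
  next
    case (Suc j)
    have "vec.dim (R (Suc j)) \<noteq> vec.dim (R j)"
      using vec.subspace_dim_equal[OF sub sub anti, of j] strict[of j] Suc.prems by fastforce
    then have "vec.dim (R (Suc j)) < vec.dim (R j)"
      using vec.dim_subset[OF anti, of j] by linarith
    then show ?case using Suc by simp
  qed
  from this[of "Suc k"] show False using assms by simp
qed

lemma vec_mult_ring_reduct_pow:
  "(X [^]\<^bsub>ring_reduct (R_alg q)\<^esub> (k::nat)) *v v = (((*v) X) ^^ k) v"
  by (induction k arbitrary: v)
    (simp_all add: ring_reduct_def R_alg_def nat_pow_def matrix_vector_mul_assoc[symmetric]
      funpow_Suc_right del: funpow.simps(2))

text \<open>Multiplies on the right, as \<open>[^]\<close> does, so that \<open>eval_tpow\<close>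
  holds in every structure without associativity.\<close>

primrec tpow :: "('f, 'v) qterm \<Rightarrow> nat \<Rightarrow> ('f, 'v) qterm" where
  "tpow t 0 = TOne"
| "tpow t (Suc k) = TMult (tpow t k) t"

lemma eval_tpow: "eval A v (tpow t k) = eval A v t [^]\<^bsub>ring_reduct A\<^esub> k"
  by (induction k) (simp_all add: ring_reduct_def nat_pow_def)

lemma R_alg_pow_identity:
  fixes X :: "'f::field^3^3"
  assumes q: "admissible_quasi_inversion q" and "3 \<le> k"
  defines "S \<equiv> ring_reduct (R_alg q)"
  shows "X [^]\<^bsub>S\<^esub> Suc k ** q (X [^]\<^bsub>S\<^esub> Suc k) ** X [^]\<^bsub>S\<^esub> k = X [^]\<^bsub>S\<^esub> k"
  unfolding matrix_eq
proof
  fix v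
  let ?P = "X [^]\<^bsub>S\<^esub> Suc k"
  \<comment> \<open>Stabilisation applies because \<open>CARD(3)\<close> is 3. It writes the vector
    as \<open>?P *v w\<close>, on which \<open>?P ** q ?P\<close> acts trivially.\<close>
  have "X [^]\<^bsub>S\<^esub> k *v v \<in> range (((*v) X) ^^ Suc k)"
    using range_matrix_funpow_stabilises[of k X] assms(2) by (auto simp: S_def vec_mult_ring_reduct_pow)
  then obtain w where w: "X [^]\<^bsub>S\<^esub> k *v v = ?P *v w"
    unfolding S_def vec_mult_ring_reduct_pow by blast
  have "(?P ** q ?P ** X [^]\<^bsub>S\<^esub> k) *v v = (?P ** q ?P ** ?P) *v w"
    by (simp only: matrix_vector_mul_assoc[symmetric] w)
  then show "(?P ** q ?P ** X [^]\<^bsub>S\<^esub> k) *v v = X [^]\<^bsub>S\<^esub> k *v v"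
    using q w by (simp add: admissible_quasi_inversion_def)
qed

lemma pow_eq_zero_descend:
  fixes q :: "'f::field^3^3 \<Rightarrow> 'f^3^3"
  assumes q: "admissible_quasi_inversion q" and T: "T \<in> generated_variety (R_alg q)"
    and a: "a \<in> qcarrier T" and "3 \<le> k"
    and zero: "a [^]\<^bsub>ring_reduct T\<^esub> Suc k = \<zero>\<^bsub>ring_reduct T\<^esub>"
  shows "a [^]\<^bsub>ring_reduct T\<^esub> k = \<zero>\<^bsub>ring_reduct T\<^esub>"
proof -
  note qi = generated_variety_qi_algebra[OF qi_algebra_R_alg[OF q] T]
  then interpret T: ring "ring_reduct T" by (simp add: qi_algebra_def)
  let ?s = "\<lambda>n. tpow (TVar 0) n :: ('f, nat) qterm"
  let ?z = "\<zero>\<^bsub>ring_reduct T\<^esub>"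
  \<comment> \<open>The identity has the single variable 0, so a constant assignment
    suffices.\<close>
  have "eval T (\<lambda>_. a) (TMult (TMult (?s (Suc k)) (TInv (?s (Suc k)))) (?s k))
      = eval T (\<lambda>_. a) (?s k)"
  proof (rule generated_variety_transfer[OF T])
    fix v :: "nat \<Rightarrow> 'f^3^3"
    show "eval (R_alg q) v (TMult (TMult (?s (Suc k)) (TInv (?s (Suc k)))) (?s k))
        = eval (R_alg q) v (?s k)"
      using R_alg_pow_identity[OF q \<open>3 \<le> k\<close>, of "v 0"]
      by (simp add: eval_tpow R_alg_def del: tpow.simps)
  qed (use a in auto)
  then have "(?z \<otimes>\<^bsub>ring_reduct T\<^esub> qinv T ?z) \<otimes>\<^bsub>ring_reduct T\<^esub> a [^]\<^bsub>ring_reduct T\<^esub> k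
      = a [^]\<^bsub>ring_reduct T\<^esub> k"
    using zero by (simp add: eval_tpow ring_reduct_def del: tpow.simps)
  \<comment> \<open>Whatever the value of \<open>qinv T ?z\<close>, lying in the carrier is enough
    for zero to absorb it.\<close>
  moreover have "qinv T ?z \<in> carrier (ring_reduct T)" "a \<in> carrier (ring_reduct T)"
    using qi a by (auto simp: qi_algebra_def sigma_structure_def ring_reduct_def)
  ultimately show ?thesis by simp
qed

text \<open>The element type of \<open>T\<close> is left free, since the chain algebra consists of
  classes of terms.\<close>

lemma ring_index_le_3:
  fixes q :: "'f::field^3^3 \<Rightarrow> 'f^3^3"
  assumes q: "admissible_quasi_inversion q" and T: "T \<in> generated_variety (R_alg q)"
  shows "ring_index (ring_reduct T) \<le> 3"
  unfolding ring_index_def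
proof (rule SUP_least)
  fix a assume "a \<in> nilpotents (ring_reduct T)"
  then obtain n where a: "a \<in> carrier (ring_reduct T)"
    and n: "a [^]\<^bsub>ring_reduct T\<^esub> (n::nat) = \<zero>\<^bsub>ring_reduct T\<^esub>"
    by (auto simp: nilpotents_def)
  interpret T: ring "ring_reduct T"
    using generated_variety_qi_algebra[OF qi_algebra_R_alg[OF q] T] by (simp add: qi_algebra_def)
  \<comment> \<open>Raising the exponent to at least 3 gives a starting point for the descent also
    when \<open>n < 3\<close>.\<close>
  have "a [^]\<^bsub>ring_reduct T\<^esub> (max n 3) = a [^]\<^bsub>ring_reduct T\<^esub> n \<otimes>\<^bsub>ring_reduct T\<^esub> a [^]\<^bsub>ring_reduct T\<^esub> (max n 3 - n)"
    using a by (simp add: T.nat_pow_mult)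
  then have "a [^]\<^bsub>ring_reduct T\<^esub> (max n 3) = \<zero>\<^bsub>ring_reduct T\<^esub>"
    using a n by simp
  \<comment> \<open>Induction on \<open>j\<close> from 3 upward, for the claim that a vanishing
    \<open>j\<close>-th power forces a vanishing cube.\<close>
  with max.cobounded2[of 3 n] have "a [^]\<^bsub>ring_reduct T\<^esub> (3::nat) = \<zero>\<^bsub>ring_reduct T\<^esub>"
  proof (induction rule: dec_induct)
    case (step k)
    then show ?case using pow_eq_zero_descend[OF q T, of a k] a by (simp add: ring_reduct_def)
  qed
  then have "nilpotence_index (ring_reduct T) a \<le> 3"
    unfolding nilpotence_index_def by (intro Least_le) simp
  then show "enat (nilpotence_index (ring_reduct T) a) \<le> 3"
    by (simp add: numeral_eq_enat)
qed

theorem proposition4p5: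
  fixes q :: "'f::field^3^3 \<Rightarrow> 'f^3^3"
  assumes "countable (UNIV :: 'f set)"
    and "admissible_quasi_inversion q"
  shows "(\<forall>T :: ('f, 'a) qstruct. T \<in> generated_variety (R_alg q) \<longrightarrow>
            ring_index (ring_reduct T) \<le> 3) \<and>
         (\<forall>(L :: 'l set) (r :: 'l rel). linear_order_on L r \<longrightarrow>
            ring_index (ring_reduct (chain_algebra (identities (R_alg q)) L r)) \<le> 3)"
proof (intro conjI allI impI)
  show "ring_index (ring_reduct T) \<le> 3" if "T \<in> generated_variety (R_alg q)"
    for T :: "('f, 'a) qstruct"
    using ring_index_le_3[OF assms(2) that] .
  show "ring_index (ring_reduct (chain_algebra (identities (R_alg q)) L r)) \<le> 3"
    for L :: "'l set" and r :: "'l rel"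
    \<comment> \<open>A presented algebra satisfies the identities that it is built from, so it is
      itself a member of the variety.\<close>
    unfolding chain_algebra_def
    by (rule ring_index_le_3[OF assms(2)]) (simp add: generated_variety_def presented_in_models)
qed

end
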